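(* Let $K\ge 2$ and $N\ge 1$ be integers, let $\Theta\subseteq\mathbb{R}^N$, let $f:\mathbb{Z}_K^N\times\Theta\to\mathbb{R}$ be a function, let $\theta\in\Theta$, and let $\tau>0$. Then $f$ admits $\tau$-robust label inference using $\theta$ if and only if $\Lambda_\theta(f)\ge 2\tau$.
   Context: $\mathbb{Z}_K=\{0,1,\dots,K-1\}$ is the set of label classes and $\mathbb{Z}_K^N$ is the set of all labelings of $N$ datapoints. For $\theta\in\Theta$, $\Lambda_\theta(f):=\min\{|f(\sigma_1,\theta)-f(\sigma_2,\theta)| : \sigma_1,\sigma_2\in\mathbb{Z}_K^N,\ \sigma_1\ne\sigma_2\}$. $f$ admits $\tau$-robust label inference using $\theta$ if there is an algorithm $\mathcal{A}$ such that for every $\sigma^\star\in\mathbb{Z}_K^N$ and every $\ell\in\mathbb{R}$ with $|f(\sigma^\star,\theta)-\ell|<\tau$ one has $\mathcal{A}(\theta,N,\ell)=\sigma^\star$. The algorithm may depend on the known function $f$ but not on $\sigma^\star$. The model is exact (arbitrary-precision) arithmetic on reals with the ability to evaluate $f$, so existence of an algorithm amounts to existence of a map $(\theta,N,\ell)\mapsto\mathcal{A}(\theta,N,\ell)\in\mathbb{Z}_K^N$ with the stated property. *)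

theory Defs
  imports Complex_Main "HOL-Library.FuncSet"
begin

text \<open>
  Vectors of length \<open>N\<close> are extensional functions on \<open>{..<N}\<close> (with value \<open>undefined\<close> outside),
  so that HOL equality of two vectors is equality of their \<open>N\<close> coordinates.
\<close>

definition labelings :: "nat \<Rightarrow> nat \<Rightarrow> (nat \<Rightarrow> nat) set" where
  "labelings K N = ({..<N} \<rightarrow>\<^sub>E {..<K})"

definition real_vectors :: "nat \<Rightarrow> (nat \<Rightarrow> real) set" where
  "real_vectors N = ({..<N} \<rightarrow>\<^sub>E (UNIV :: real set))"

text \<open>
  The minimum is over a finite set, which is nonempty whenever \<open>K \<ge> 2\<close> and \<open>N \<ge> 1\<close>.
\<close>

definition min_gap ::
  "nat \<Rightarrow> nat \<Rightarrow> ((nat \<Rightarrow> nat) \<Rightarrow> (nat \<Rightarrow> real) \<Rightarrow> real) \<Rightarrow> (nat \<Rightarrow> real) \<Rightarrow> real" where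
  "min_gap K N f \<theta> =
     Min {\<bar>f \<sigma>1 \<theta> - f \<sigma>2 \<theta>\<bar> | \<sigma>1 \<sigma>2.
            \<sigma>1 \<in> labelings K N \<and> \<sigma>2 \<in> labelings K N \<and> \<sigma>1 \<noteq> \<sigma>2}"

text \<open>
  In the model of exact real arithmetic with evaluation of \<open>f\<close>, an algorithm is an arbitrary map
  \<open>(\<theta>, N, l) \<mapsto> \<A> \<theta> N l\<close> that outputs a labeling on every input. It is chosen after
  \<open>f\<close> but before the hidden labeling \<open>\<sigma>\<close>.
\<close>

definition robust_label_inference ::
  "nat \<Rightarrow> nat \<Rightarrow> (nat \<Rightarrow> real) set \<Rightarrow> ((nat \<Rightarrow> nat) \<Rightarrow> (nat \<Rightarrow> real) \<Rightarrow> real)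
    \<Rightarrow> real \<Rightarrow> (nat \<Rightarrow> real) \<Rightarrow> bool" where
  "robust_label_inference K N \<Theta> f \<tau> \<theta> \<longleftrightarrow>
     (\<exists>\<A> :: (nat \<Rightarrow> real) \<Rightarrow> nat \<Rightarrow> real \<Rightarrow> (nat \<Rightarrow> nat).
        (\<forall>\<theta>'\<in>\<Theta>. \<forall>l. \<A> \<theta>' N l \<in> labelings K N) \<and>
        (\<forall>\<sigma>\<in>labelings K N. \<forall>l. \<bar>f \<sigma> \<theta> - l\<bar> < \<tau> \<longrightarrow> \<A> \<theta> N l = \<sigma>))"

end

theory Submission
  imports Defs
begin

text \<open>
  A noisy value \<open>l\<close> determines the labeling as long as the open intervals of radius \<open>\<tau>\<close> around the
  values \<open>f \<sigma> \<theta>\<close> are pairwise disjoint, that is, as long as their centres are at least \<open>2 * \<tau>\<close>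
  apart. If two centres are closer, their midpoint is a value that no map can decode correctly for
  both labelings.
\<close>

lemma finite_labelings: "finite (labelings K N)"
  by (simp add: labelings_def finite_PiE)

text \<open>Two classes and one coordinate suffice: the constant labelings 0 and 1 differ at index
  0. This guarantees that the minimum in \<open>min_gap\<close> ranges over a nonempty set.\<close>

lemma labelings_distinct:
  assumes "K \<ge> 2" and "N \<ge> 1"
  obtains \<sigma>1 \<sigma>2 where "\<sigma>1 \<in> labelings K N" "\<sigma>2 \<in> labelings K N" "\<sigma>1 \<noteq> \<sigma>2"
proof
  let ?c = "\<lambda>k::nat. restrict (\<lambda>_. k) {..<N}"
  show "?c 0 \<in> labelings K N" "?c 1 \<in> labelings K N"
    using assms by (auto simp: labelings_def)
  have "?c 0 0 \<noteq> ?c 1 0"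
    using assms by simp
  then show "?c 0 \<noteq> ?c 1"
    by metis
qed

text \<open>\<open>Min\<close> is characterised by its lower bounds only on finite nonempty sets.
  The gaps are finitely many because they come from pairs of labelings. The result replaces the
  minimum by a pairwise separation condition.\<close>

lemma le_min_gap_iff:
  assumes "K \<ge> 2" and "N \<ge> 1"
  shows "c \<le> min_gap K N f \<theta> \<longleftrightarrow>
    (\<forall>\<sigma>1\<in>labelings K N. \<forall>\<sigma>2\<in>labelings K N. \<sigma>1 \<noteq> \<sigma>2 \<longrightarrow> c \<le> \<bar>f \<sigma>1 \<theta> - f \<sigma>2 \<theta>\<bar>)"
proof -
  let ?G = "{\<bar>f \<sigma>1 \<theta> - f \<sigma>2 \<theta>\<bar> | \<sigma>1 \<sigma>2.
    \<sigma>1 \<in> labelings K N \<and> \<sigma>2 \<in> labelings K N \<and> \<sigma>1 \<noteq> \<sigma>2}"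
  have "?G \<subseteq> (\<lambda>(\<sigma>1, \<sigma>2). \<bar>f \<sigma>1 \<theta> - f \<sigma>2 \<theta>\<bar>) ` (labelings K N \<times> labelings K N)"
    by auto
  then have "finite ?G"
    by (rule finite_subset) (simp add: finite_labelings)
  moreover have "?G \<noteq> {}"
    using labelings_distinct[OF assms] by blast
  ultimately show ?thesis
    unfolding min_gap_def by (subst Min_ge_iff) auto
qed

text \<open>Nonemptiness of the labelings provides an output for those \<open>l\<close> that are not
  within \<tau> of any value of \<open>f\<close>.\<close>

lemma robust_label_inference_iff:
  assumes "labelings K N \<noteq> {}"
  shows "robust_label_inference K N \<Theta> f \<tau> \<theta> \<longleftrightarrow>
    (\<forall>\<sigma>1\<in>labelings K N. \<forall>\<sigma>2\<in>labelings K N. \<sigma>1 \<noteq> \<sigma>2 \<longrightarrow> 2 * \<tau> \<le> \<bar>f \<sigma>1 \<theta> - f \<sigma>2 \<theta>\<bar>)"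
    (is "_ \<longleftrightarrow> ?separated")
proof
  assume "robust_label_inference K N \<Theta> f \<tau> \<theta>"
  then obtain \<A> where \<A>: "\<And>\<sigma> l. \<sigma> \<in> labelings K N \<Longrightarrow> \<bar>f \<sigma> \<theta> - l\<bar> < \<tau> \<Longrightarrow> \<A> \<theta> N l = \<sigma>"
    unfolding robust_label_inference_def by blast
  show ?separated
  proof (intro ballI impI, rule ccontr)
    fix \<sigma>1 \<sigma>2
    assume \<sigma>: "\<sigma>1 \<in> labelings K N" "\<sigma>2 \<in> labelings K N" "\<sigma>1 \<noteq> \<sigma>2"
      and close: "\<not> 2 * \<tau> \<le> \<bar>f \<sigma>1 \<theta> - f \<sigma>2 \<theta>\<bar>"
    \<comment> \<open>The midpoint is at distance half the gap, hence less than \<tau>, from both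
      values, so \<open>\<A>\<close> would have to return both labelings on
      \<open>m\<close>.\<close>
    define m where "m = (f \<sigma>1 \<theta> + f \<sigma>2 \<theta>) / 2"
    have "\<bar>f \<sigma>1 \<theta> - m\<bar> < \<tau>" "\<bar>f \<sigma>2 \<theta> - m\<bar> < \<tau>"
      using close by (simp_all add: m_def abs_if field_simps split: if_splits)
    then show False
      using \<A>[of \<sigma>1 m] \<A>[of \<sigma>2 m] \<sigma> by simp
  qed
next
  assume separated: ?separated
  obtain \<sigma>0 where \<sigma>0: "\<sigma>0 \<in> labelings K N"
    using assms(1) by blast
  define P where "P = (\<lambda>l \<sigma>. \<sigma> \<in> labelings K N \<and> \<bar>f \<sigma> \<theta> - l\<bar> < \<tau>)"
  have unique: "\<sigma> = \<rho>" if "P l \<sigma>" "P l \<rho>" for l \<sigma> \<rho>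
  proof (rule ccontr)
    assume "\<sigma> \<noteq> \<rho>"
    then have "2 * \<tau> \<le> \<bar>f \<sigma> \<theta> - f \<rho> \<theta>\<bar>"
      using separated that unfolding P_def by blast
    \<comment> \<open>By the triangle inequality through \<open>l\<close>, two values within \<tau>
      of \<open>l\<close> are less than \<open>2 * \<tau>\<close> apart.\<close>
    then show False
      using that unfolding P_def by linarith
  qed
  \<comment> \<open>Since \<open>P\<close> already fixes \<open>\<theta>\<close> and
    \<open>N\<close>, the decoder depends on \<open>l\<close> alone. The default
    \<open>\<sigma>0\<close> keeps its output a labeling when no candidate exists.\<close>
  define \<A> where "\<A> = (\<lambda>(_ :: nat \<Rightarrow> real) (_ :: nat) l. if \<exists>\<sigma>. P l \<sigma> then SOME \<sigma>. P l \<sigma> else \<sigma>0)"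
  have \<A>_P: "P l (\<A> \<theta>' n l)" if "P l \<sigma>" for \<theta>' n l \<sigma>
    using that someI[of "P l" \<sigma>] by (auto simp: \<A>_def)
  have "\<A> \<theta>' n l \<in> labelings K N" for \<theta>' n l
  proof (cases "\<exists>\<sigma>. P l \<sigma>")
    case True
    then show ?thesis
      using \<A>_P unfolding P_def by blast
  next
    case False
    then have "\<A> \<theta>' n l = \<sigma>0"
      unfolding \<A>_def by (rule if_not_P)
    then show ?thesis
      using \<sigma>0 by simp
  qed
  moreover have "\<A> \<theta> N l = \<sigma>" if "\<sigma> \<in> labelings K N" "\<bar>f \<sigma> \<theta> - l\<bar> < \<tau>" for \<sigma> l
  proof -
    have "P l \<sigma>"
      using that by (simp add: P_def)
    then show ?thesis
      using unique[OF \<A>_P] by simp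
  qed
  ultimately show "robust_label_inference K N \<Theta> f \<tau> \<theta>"
    unfolding robust_label_inference_def by (intro exI[of _ \<A>]) simp
qed

theorem proposition1:
  fixes K N :: nat
    and \<Theta> :: "(nat \<Rightarrow> real) set"
    and f :: "(nat \<Rightarrow> nat) \<Rightarrow> (nat \<Rightarrow> real) \<Rightarrow> real"
    and \<theta> :: "nat \<Rightarrow> real"
    and \<tau> :: real
  assumes "K \<ge> 2" and "N \<ge> 1"
    and "\<Theta> \<subseteq> real_vectors N"
    and "\<theta> \<in> \<Theta>"
    and "\<tau> > 0"
  shows "robust_label_inference K N \<Theta> f \<tau> \<theta> \<longleftrightarrow> min_gap K N f \<theta> \<ge> 2 * \<tau>"
proof -
  have "labelings K N \<noteq> {}"
    using labelings_distinct[OF assms(1,2)] by blast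
  then show ?thesis
    by (simp add: robust_label_inference_iff le_min_gap_iff[OF assms(1,2)])
qed

end
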